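(* Let $\mathbb{H}$ be the hexahedron (cube) graph, i.e., the graph formed by the $8$ vertices and $12$ edges of a cube. Then $k(\mathbb{H})=6$.
   Context: All graphs are simple and undirected. The competition graph $C(D)$ of a digraph $D$ is the graph with vertex set $V(D)$ in which two distinct vertices $x,y$ are adjacent if and only if there is a vertex $v$ with $(x,v)$ and $(y,v)$ both arcs of $D$. The competition number $k(G)$ of a graph $G$ is the minimum integer $k\ge 0$ such that $G$ together with $k$ new isolated vertices is the competition graph of some acyclic digraph. *)

theory Defs
  imports "Graph_Theory.Pair_Digraph"
begin

text \<open>
  As in the imported library, a simple undirected graph is a symmetric, loop-free digraph
  without parallel arcs (\<^locale>\<open>pair_graph\<close>): the edge joining \<open>x\<close> and \<open>y\<close> is the pair of arcs
  \<open>(x, y)\<close> and \<open>(y, x)\<close>.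
\<close>

definition competition_graph :: "'a pair_pre_digraph \<Rightarrow> 'a pair_pre_digraph" where
  "competition_graph D =
    \<lparr> pverts = pverts D,
      parcs = {(x, y). x \<noteq> y \<and> (\<exists>v. (x, v) \<in> parcs D \<and> (y, v) \<in> parcs D)} \<rparr>"

definition acyclic_digraph :: "'a pair_pre_digraph \<Rightarrow> bool" where
  "acyclic_digraph D \<longleftrightarrow> pair_wf_digraph D \<and> acyclic (parcs D)"

text \<open>The new vertices are \<open>Inr 0, \<dots>, Inr (k - 1)\<close>; the sum type keeps them apart from those of \<open>G\<close>.\<close>

definition add_isolated :: "'a pair_pre_digraph \<Rightarrow> nat \<Rightarrow> ('a + nat) pair_pre_digraph" where
  "add_isolated G k =
    \<lparr> pverts = Inl ` pverts G \<union> Inr ` {..<k},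
      parcs = map_prod Inl Inl ` parcs G \<rparr>"

definition competition_number :: "'a pair_pre_digraph \<Rightarrow> nat" where
  "competition_number G =
    (LEAST k. \<exists>D. acyclic_digraph D \<and> competition_graph D = add_isolated G k)"

text \<open>The minimum is over a nonempty set for every finite simple graph.\<close>

lemma competition_number_exists:
  assumes "pair_graph G"
  shows "\<exists>k D. acyclic_digraph D \<and> competition_graph D = add_isolated G k"
proof -
  interpret pair_graph G by fact
  obtain f where f: "bij_betw f {..<card (parcs G)} (parcs G)"
    using ex_bij_betw_nat_finite[OF pair_finite_arcs] by (auto simp: atLeast0LessThan)
  define k where "k = card (parcs G)"
  define A where "A = {(Inl x :: 'a + nat, Inr i :: 'a + nat) | x i. i < k \<and> (x = fst (f i) \<or> x = snd (f i))}"
  define D where "D = \<lparr> pverts = Inl ` pverts G \<union> Inr ` {..<k}, parcs = A \<rparr>"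
  have fi: "f i \<in> parcs G" if "i < k" for i
    using f that by (auto simp: bij_betw_def k_def)
  have wf: "pair_wf_digraph D"
    by unfold_locales
      (auto simp: D_def A_def fi arc_fst_in_verts arc_snd_in_verts)
  have "\<not> isl y" if "(x, y) \<in> A\<^sup>+" for x y
    using that by induction (auto simp: A_def)
  moreover have "isl x" if "(x, y) \<in> A\<^sup>+" for x y
    using that by induction (auto simp: A_def)
  ultimately have "acyclic A"
    unfolding acyclic_def by blast
  have sym: "(y, x) \<in> parcs G" if "(x, y) \<in> parcs G" for x y
    using that pair_sym_arcs by (auto simp: symmetric_def elim: symE)
  have "(x, y) \<in> map_prod Inl Inl ` parcs G
      \<longleftrightarrow> x \<noteq> y \<and> (\<exists>v. (x, v) \<in> A \<and> (y, v) \<in> A)" (is "?L \<longleftrightarrow> ?R") for x y :: "'a + nat"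
  proof
    assume ?L
    then obtain a b where ab: "x = Inl a" "y = Inl b" "(a, b) \<in> parcs G" by auto
    then obtain i where "i < k" "f i = (a, b)"
      using f unfolding bij_betw_def k_def by (metis imageE lessThan_iff)
    then show ?R using ab pair_no_loops by (fastforce simp: A_def)
  next
    assume ?R
    then obtain a b i where "x = Inl a" "y = Inl b" "a \<noteq> b" "i < k"
      "a = fst (f i) \<or> a = snd (f i)" "b = fst (f i) \<or> b = snd (f i)"
      by (auto simp: A_def)
    moreover from this have "(a, b) \<in> parcs G"
      using fi[of i] sym[of "fst (f i)" "snd (f i)"] by auto
    ultimately show ?L by force
  qed
  then have "map_prod Inl Inl ` parcs G = {(x, y). x \<noteq> y \<and> (\<exists>v. (x, v) \<in> A \<and> (y, v) \<in> A)}"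
    by (intro set_eqI) (simp only: split_paired_all mem_Collect_eq case_prod_conv)
  then have "competition_graph D = add_isolated G k"
    by (simp add: competition_graph_def add_isolated_def D_def)
  moreover have "acyclic_digraph D"
    using wf \<open>acyclic A\<close> by (simp add: acyclic_digraph_def D_def)
  ultimately show ?thesis by blast
qed

text \<open>
  The vertices of the cube \<open>[0, 1]\<^sup>3\<close> are the 0-1 triples; its edges join the triples that differ
  in exactly one coordinate.
\<close>

definition hexahedron :: "(nat \<times> nat \<times> nat) pair_pre_digraph" where
  "hexahedron =
    \<lparr> pverts = {0, 1} \<times> {0, 1} \<times> {0, 1},
      parcs = {(u, v). u \<in> {0, 1} \<times> {0, 1} \<times> {0, 1} \<and> v \<in> {0, 1} \<times> {0, 1} \<times> {0, 1} \<and>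
        (case u of (a, b, c) \<Rightarrow> case v of (a', b', c') \<Rightarrow>
          (a \<noteq> a' \<and> b = b' \<and> c = c') \<or>
          (a = a' \<and> b \<noteq> b' \<and> c = c') \<or>
          (a = a' \<and> b = b' \<and> c \<noteq> c'))} \<rparr>"

lemma pair_graph_hexahedron: "pair_graph hexahedron"
proof -
  define V :: "(nat \<times> nat \<times> nat) set" where "V = {0, 1} \<times> {0, 1} \<times> {0, 1}"
  have "finite V"
    by (simp add: V_def)
  note hex = hexahedron_def[folded V_def]
  show ?thesis
  proof
    show "finite (parcs hexahedron)"
      by (rule finite_subset[of _ "V \<times> V"]) (use \<open>finite V\<close> in \<open>auto simp: hex\<close>)
  qed (use \<open>finite V\<close> in \<open>auto simp: hex symmetric_def intro!: symI\<close>)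
qed

lemma card_verts_hexahedron: "card (pverts hexahedron) = 8"
  by (simp add: hexahedron_def card_cartesian_product)

lemma card_arcs_hexahedron: "card (parcs hexahedron) = 2 * 12"
proof -
  define vs :: "(nat \<times> nat \<times> nat) list"
    where "vs = List.product [0, 1] (List.product [0, 1] [0, 1])"
  have vs: "{0, 1} \<times> {0, 1} \<times> {0, 1} = set vs"
    by (simp only: vs_def set_product list.set)
  have "parcs hexahedron = set (filter
      (\<lambda>(u, v). case u of (a, b, c) \<Rightarrow> case v of (a', b', c') \<Rightarrow>
        (a \<noteq> a' \<and> b = b' \<and> c = c') \<or> (a = a' \<and> b \<noteq> b' \<and> c = c') \<or> (a = a' \<and> b = b' \<and> c \<noteq> c'))
      (List.product vs vs))"
    unfolding hexahedron_def vs by auto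
  also have "card \<dots> = 2 * 12"
    by (subst distinct_card) (simp_all add: vs_def distinct_product)
  finally show ?thesis .
qed

end

theory Submission
  imports Defs
begin

text \<open>
  In an acyclic digraph whose competition graph is triangle-free, every vertex has at most two
  in-neighbours, so it accounts for at most one edge of the competition graph, and the first two
  vertices of an acyclic ordering account for none. Hence a triangle-free graph with \<open>n\<close> vertices
  and \<open>m\<close> edges needs \<open>m \<le> n + k - 2\<close>; for the cube this gives \<open>k \<ge> 6\<close>. Conversely, follow a
  Hamiltonian path of the cube: the \<open>i\<close>-th of its edges may get the \<open>(i + 2)\<close>-nd vertex as common
  prey, and the last path edge and the five remaining edges take the six new vertices.
\<close>

section \<open>Counting arcs of a triangle-free competition graph\<close>

lemma acyclic_two_sources:
  assumes "finite V" "A \<subseteq> V \<times> V" "acyclic A" "2 \<le> card V"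
  obtains s t where "s \<in> V" "t \<in> V" "s \<noteq> t"
    "\<And>x. (x, s) \<notin> A" "\<And>x. (x, t) \<in> A \<Longrightarrow> x = s"
proof -
  have "finite A"
    using assms by (meson finite_SigmaI finite_subset)
  then have wf: "wf A"
    using \<open>acyclic A\<close> by (rule finite_acyclic_wf)
  have "V \<noteq> {}"
    using assms(4) by auto
  then obtain s where s: "s \<in> V" "\<And>x. (x, s) \<in> A \<Longrightarrow> x \<notin> V"
    using wfE_min'[OF wf, of V] by metis
  \<comment> \<open>\<open>t\<close> will be a source of the digraph left after deleting
    \<open>s\<close>, so only \<open>s\<close> can point to it.\<close>
  have "V - {s} \<noteq> {}"
    using assms(1,4) s(1) card_Diff_singleton[of s V] by force
  then obtain t where t: "t \<in> V - {s}" "\<And>x. (x, t) \<in> A \<Longrightarrow> x \<notin> V - {s}"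
    using wfE_min'[OF wf, of "V - {s}"] by metis
  show thesis
    by (rule that[of s t]) (use s t assms(2) in blast)+
qed

text \<open>In a loop-free graph the three arcs force \<open>x\<close>, \<open>y\<close>,
  \<open>z\<close> to be distinct.\<close>

definition triangle_free :: "'a pair_pre_digraph \<Rightarrow> bool" where
  "triangle_free G \<longleftrightarrow>
    (\<nexists>x y z. (x, y) \<in> parcs G \<and> (y, z) \<in> parcs G \<and> (x, z) \<in> parcs G)"

text \<open>Each edge is a pair of opposite arcs, hence the factor 2: all vertices but two can be
  common prey, each for at most one edge.\<close>

lemma card_arcs_competition_graph_le:
  assumes "acyclic_digraph D" "finite (pverts D)" "2 \<le> card (pverts D)"
    and "triangle_free (competition_graph D)"
  shows "card (parcs (competition_graph D)) \<le> 2 * (card (pverts D) - 2)"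
proof -
  define V A where "V = pverts D" and "A = parcs D"
  define F where "F v = {(x, y). x \<noteq> y \<and> (x, v) \<in> A \<and> (y, v) \<in> A}" for v
  have A: "A \<subseteq> V \<times> V" "acyclic A"
    using assms(1) pair_wf_digraph.arc_fst_in_verts pair_wf_digraph.arc_snd_in_verts
    by (fastforce simp: acyclic_digraph_def V_def A_def)+
  obtain s t where st: "s \<in> V" "t \<in> V" "s \<noteq> t"
    "\<And>x. (x, s) \<notin> A" "\<And>x. (x, t) \<in> A \<Longrightarrow> x = s"
    using acyclic_two_sources[OF _ A] assms(2,3) unfolding V_def by blast
  have card_F: "card (F v) \<le> 2" for v
  proof (cases "F v = {}")
    case False
    then obtain x y where xy: "(x, v) \<in> A" "(y, v) \<in> A" "x \<noteq> y"
      by (auto simp: F_def)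
    \<comment> \<open>Three in-neighbours of \<open>v\<close> would be pairwise adjacent in the
      competition graph, a triangle.\<close>
    have "z = x \<or> z = y" if "(z, v) \<in> A" for z
      using assms(4) xy that
      by (auto simp: triangle_free_def competition_graph_def A_def)
    then have "F v \<subseteq> {(x, y), (y, x)}"
      by (auto simp: F_def)
    then have "card (F v) \<le> card {(x, y), (y, x)}"
      by (intro card_mono) auto
    then show ?thesis
      using xy by simp
  qed simp
  have F_arcs: "parcs (competition_graph D) \<subseteq> (\<Union>v\<in>V - {s, t}. F v)"
  proof clarify
    fix x y
    assume "(x, y) \<in> parcs (competition_graph D)"
    then obtain v where "x \<noteq> y" "(x, v) \<in> A" "(y, v) \<in> A"
      by (auto simp: competition_graph_def A_def)
    \<comment> \<open>\<open>v\<close> has two distinct in-neighbours, while \<open>s\<close> has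
      none and \<open>t\<close> at most one.\<close>
    moreover from this have "v \<in> V" "v \<noteq> s" "v \<noteq> t"
      using st A by blast+
    ultimately show "(x, y) \<in> (\<Union>v\<in>V - {s, t}. F v)"
      by (auto simp: F_def)
  qed
  have fin: "finite V"
    using assms(2) by (simp add: V_def)
  have "F v \<subseteq> V \<times> V" for v
    using A by (auto simp: F_def)
  then have "finite (F v)" for v
    using fin by (meson finite_SigmaI finite_subset)
  then have "card (parcs (competition_graph D)) \<le> card (\<Union>v\<in>V - {s, t}. F v)"
    using fin F_arcs by (intro card_mono) auto
  also have "\<dots> \<le> (\<Sum>v\<in>V - {s, t}. card (F v))"
    using fin by (intro card_UN_le) auto
  also have "\<dots> \<le> card (V - {s, t}) * 2"
    using sum_bounded_above[of "V - {s, t}" "\<lambda>v. card (F v)" 2] card_F by simp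
  also have "card (V - {s, t}) = card V - 2"
    using fin st by (subst card_Diff_subset) auto
  finally show ?thesis
    by (simp add: V_def)
qed

lemma triangle_free_add_isolated:
  assumes "triangle_free G"
  shows "triangle_free (add_isolated G k)"
  using assms by (auto simp: triangle_free_def add_isolated_def)

lemma card_arcs_add_isolated:
  fixes G :: "'a pair_pre_digraph"
  shows "card (parcs (add_isolated G k)) = card (parcs G)"
proof -
  have "inj (map_prod Inl Inl :: 'a \<times> 'a \<Rightarrow> ('a + nat) \<times> ('a + nat))"
    by (simp add: prod.inj_map)
  then show ?thesis
    by (simp add: add_isolated_def card_image inj_on_subset)
qed

lemma card_verts_add_isolated:
  assumes "finite (pverts G)"
  shows "card (pverts (add_isolated G k)) = card (pverts G) + k"
  using assms unfolding add_isolated_def pair_pre_digraph.simps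
  by (subst card_Un_disjoint) (auto simp: card_image)

text \<open>Isolated vertices create neither arcs nor triangles, so only the vertex count in the
  previous bound grows, by \<open>k\<close>.\<close>

lemma triangle_free_competition_bound:
  assumes "finite (pverts G)" "2 \<le> card (pverts G)" "triangle_free G"
    and "acyclic_digraph D" "competition_graph D = add_isolated G k"
  shows "card (parcs G) \<le> 2 * (card (pverts G) + k - 2)"
proof -
  have "pverts D = pverts (competition_graph D)"
    by (simp add: competition_graph_def)
  then have verts: "pverts D = pverts (add_isolated G k)"
    by (simp only: assms(5))
  then have card: "card (pverts D) = card (pverts G) + k"
    using card_verts_add_isolated[OF assms(1)] by simp
  moreover have "finite (pverts D)"
    using assms(1) verts by (simp add: add_isolated_def)
  ultimately show ?thesis
    using card_arcs_competition_graph_le[of D] assms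
    by (simp add: triangle_free_add_isolated card_arcs_add_isolated)
qed

section \<open>Realizing a graph from orderings of its vertices and edges\<close>

text \<open>The \<open>i\<close>-th edge gets the vertex at index \<open>i + 2\<close> of \<open>ws\<close> as its only common prey.\<close>

lemma competition_graph_of_edge_list:
  fixes ws :: "'a list" and es :: "('a \<times> 'a) list"
  assumes "distinct ws" "length es + 2 \<le> length ws"
    and loop_free: "\<And>x. (x, x) \<notin> set es"
    and ends: "\<And>i. i < length es \<Longrightarrow>
      fst (es ! i) \<in> set (take (i + 2) ws) \<and> snd (es ! i) \<in> set (take (i + 2) ws)"
  shows "\<exists>D. acyclic_digraph D \<and>
    competition_graph D = \<lparr> pverts = set ws, parcs = set es \<union> (set es)\<inverse> \<rparr>"
proof -
  define A where "A = {(x, ws ! (i + 2)) | x i.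
    i < length es \<and> (x = fst (es ! i) \<or> x = snd (es ! i))}"
  define D where "D = \<lparr> pverts = set ws, parcs = A \<rparr>"
  \<comment> \<open>Arcs increase the index in \<open>ws\<close>, so \<open>ws\<close> is a
    topological order of \<open>D\<close>.\<close>
  have arc_less: "\<exists>j k. x = ws ! j \<and> y = ws ! k \<and> j < k \<and> k < length ws"
    if xy: "(x, y) \<in> A" for x y
  proof -
    obtain i where i: "i < length es" "y = ws ! (i + 2)" "x = fst (es ! i) \<or> x = snd (es ! i)"
      using xy by (auto simp: A_def)
    then have "x \<in> set (take (i + 2) ws)"
      using ends by blast
    then obtain j where "j < i + 2" "x = ws ! j"
      by (auto simp: in_set_conv_nth)
    then show ?thesis
      using i assms(2) by (intro exI[of _ j] exI[of _ "i + 2"]) auto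
  qed
  have path_less: "\<exists>j k. x = ws ! j \<and> y = ws ! k \<and> j < k \<and> k < length ws"
    if "(x, y) \<in> A\<^sup>+" for x y
    using that
  proof induction
    case (base y)
    then show ?case by (rule arc_less)
  next
    case (step y z)
    then obtain j k where jk: "x = ws ! j" "y = ws ! k" "j < k" "k < length ws"
      by blast
    obtain k' l where kl: "y = ws ! k'" "z = ws ! l" "k' < l" "l < length ws"
      using arc_less[OF step.hyps(2)] by blast
    have "k = k'"
      using jk kl \<open>distinct ws\<close> nth_eq_iff_index_eq[of ws k k'] by simp
    then show ?case
      using jk kl by (intro exI[of _ j] exI[of _ l]) auto
  qed
  have "acyclic A"
    unfolding acyclic_def
  proof (intro allI notI)
    fix x
    assume "(x, x) \<in> A\<^sup>+"
    then obtain j k where "ws ! j = ws ! k" "j < k" "k < length ws"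
      using path_less by metis
    then show False
      using \<open>distinct ws\<close> nth_eq_iff_index_eq[of ws j k] by simp
  qed
  moreover have "pair_wf_digraph D"
    by unfold_locales (auto simp: D_def dest!: arc_less)
  ultimately have "acyclic_digraph D"
    by (simp add: acyclic_digraph_def D_def)
  moreover have "x \<noteq> y \<and> (\<exists>v. (x, v) \<in> A \<and> (y, v) \<in> A) \<longleftrightarrow> (x, y) \<in> set es \<union> (set es)\<inverse>"
    (is "?L \<longleftrightarrow> ?R") for x y
  proof
    assume ?L
    then obtain i j where ij: "x \<noteq> y" "i < length es" "j < length es"
      "ws ! (i + 2) = ws ! (j + 2)"
      "x = fst (es ! i) \<or> x = snd (es ! i)" "y = fst (es ! j) \<or> y = snd (es ! j)"
      by (auto simp: A_def)
    \<comment> \<open>Different edges have different prey, so two competitors are the ends of one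
      edge and no unwanted adjacency arises.\<close>
    then have "i = j"
      using assms(1,2) nth_eq_iff_index_eq[of ws "i + 2" "j + 2"] by simp
    then have "es ! i = (x, y) \<or> es ! i = (y, x)"
      using ij by (metis prod.collapse)
    then show ?R
      using ij(2) by (metis UnCI converseI nth_mem)
  next
    assume ?R
    then obtain i where i: "i < length es" "es ! i = (x, y) \<or> es ! i = (y, x)"
      by (auto simp: in_set_conv_nth)
    then have "(x, ws ! (i + 2)) \<in> A" "(y, ws ! (i + 2)) \<in> A"
      unfolding A_def by force+
    then show ?L
      using \<open>?R\<close> loop_free by auto
  qed
  then have "competition_graph D = \<lparr> pverts = set ws, parcs = set es \<union> (set es)\<inverse> \<rparr>"
    unfolding competition_graph_def D_def by auto
  ultimately show ?thesis
    by blast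
qed

section \<open>The cube\<close>

lemma triangle_free_hexahedron: "triangle_free hexahedron"
proof -
  \<comment> \<open>The cube is bipartite: each edge flips the parity of the coordinate sum, which
    cannot happen three times around a triangle.\<close>
  have parity: "even (case u of (a, b, c) \<Rightarrow> a + b + c) \<noteq> even (case v of (a, b, c) \<Rightarrow> a + b + c)"
    if "(u, v) \<in> parcs hexahedron" for u v
    using that by (cases u; cases v) (auto simp: hexahedron_def)
  show ?thesis
    unfolding triangle_free_def using parity by blast
qed

lemma hexahedron_competition_6:
  "\<exists>D. acyclic_digraph D \<and> competition_graph D = add_isolated hexahedron 6"
proof -
  \<comment> \<open>A Gray code: consecutive triples differ in one coordinate. Edge \<open>i\<close>
    of the path joins its vertices \<open>i\<close> and \<open>i + 1\<close>, both among the first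
    \<open>i + 2\<close>.\<close>
  define path :: "(nat \<times> nat \<times> nat) list" where
    "path = [(0,0,0), (0,0,1), (0,1,1), (0,1,0), (1,1,0), (1,1,1), (1,0,1), (1,0,0)]"
  define edges :: "((nat \<times> nat \<times> nat) \<times> (nat \<times> nat \<times> nat)) list" where
    "edges = zip path (tl path) @
      [((0,0,0), (1,0,0)), ((0,0,0), (0,1,0)), ((0,0,1), (1,0,1)),
       ((0,1,1), (1,1,1)), ((1,1,0), (1,0,0))]"
  \<comment> \<open>The length 8 + 6 = 14 is exactly the 12 edges plus 2. Edges from index 7 on may
    join any two cube vertices, since all 8 precede their prey.\<close>
  define ws :: "(nat \<times> nat \<times> nat + nat) list" where
    "ws = map Inl path @ map Inr [0..<6]"
  define es where "es = map (map_prod Inl Inl :: _ \<Rightarrow> (_ + nat) \<times> (_ + nat)) edges"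
  have ends: "\<forall>i<12. fst (es ! i) \<in> set (take (i + 2) ws) \<and> snd (es ! i) \<in> set (take (i + 2) ws)"
    by (simp add: es_def ws_def edges_def path_def eval_nat_numeral All_less_Suc)
  have "\<exists>D. acyclic_digraph D \<and>
      competition_graph D = \<lparr> pverts = set ws, parcs = set es \<union> (set es)\<inverse> \<rparr>"
  proof (rule competition_graph_of_edge_list)
    show "distinct ws"
      by (auto simp: ws_def path_def distinct_map)
    show "length es + 2 \<le> length ws"
      by (simp add: es_def ws_def edges_def path_def)
    show "(x, x) \<notin> set es" for x
      by (auto simp: es_def edges_def path_def)
    show "fst (es ! i) \<in> set (take (i + 2) ws) \<and> snd (es ! i) \<in> set (take (i + 2) ws)"
      if "i < length es" for i
      using ends that by (simp add: es_def edges_def path_def)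
  qed
  moreover have "set ws = pverts (add_isolated hexahedron 6)"
    by (auto simp: ws_def path_def add_isolated_def hexahedron_def)
  moreover have "parcs hexahedron = set edges \<union> (set edges)\<inverse>"
  \<comment> \<open>One inclusion suffices, as both sides have 24 arcs.\<close>
  proof (rule card_subset_eq[symmetric])
    show "finite (parcs hexahedron)"
      using card_arcs_hexahedron by (intro card_ge_0_finite) simp
    show "set edges \<union> (set edges)\<inverse> \<subseteq> parcs hexahedron"
    proof -
      have "set edges \<subseteq> parcs hexahedron"
        by (simp add: edges_def path_def hexahedron_def)
      moreover have "(v, u) \<in> parcs hexahedron" if "(u, v) \<in> parcs hexahedron" for u v
        using that by (cases u; cases v) (simp add: hexahedron_def eq_commute)
      ultimately show ?thesis
        by auto
    qed
    have "set edges \<union> (set edges)\<inverse> = set (edges @ map prod.swap edges)"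
      by force
    moreover have "distinct (edges @ map prod.swap edges)"
      by (simp add: edges_def path_def)
    then have "card (set (edges @ map prod.swap edges)) = 24"
      by (subst distinct_card) (simp_all add: edges_def path_def)
    ultimately show "card (set edges \<union> (set edges)\<inverse>) = card (parcs hexahedron)"
      using card_arcs_hexahedron by simp
  qed
  then have "set es \<union> (set es)\<inverse> = parcs (add_isolated hexahedron 6)"
    by (auto simp: es_def add_isolated_def image_Un)
  ultimately show ?thesis
    by (simp add: add_isolated_def)
qed

theorem theorem2p2:
  shows "competition_number hexahedron = 6"
  unfolding competition_number_def
proof (rule Least_equality)
  show "\<exists>D. acyclic_digraph D \<and> competition_graph D = add_isolated hexahedron 6"
    by (rule hexahedron_competition_6)
next
  fix k
  assume "\<exists>D. acyclic_digraph D \<and> competition_graph D = add_isolated hexahedron k"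
  then obtain D where D: "acyclic_digraph D" "competition_graph D = add_isolated hexahedron k"
    by blast
  have "finite (pverts hexahedron)"
    by (simp add: hexahedron_def)
  then have "card (parcs hexahedron) \<le> 2 * (card (pverts hexahedron) + k - 2)"
    by (rule triangle_free_competition_bound[OF _ _ triangle_free_hexahedron D])
      (simp add: card_verts_hexahedron)
  \<comment> \<open>The bound reads 24 \<le> 2 * (8 + k - 2).\<close>
  then show "6 \<le> k"
    by (simp add: card_verts_hexahedron card_arcs_hexahedron)
qed

end
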